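(* Let $m_1,\dots,m_{N-1}>0$ and let $a_1,\dots,a_{N-1}\in\mathbb R^2$ be a normalized central configuration with constant $\mu$. Let $0\le e<1$, $p>0$, $r(\theta)=\frac{p}{1+e\cos\theta}$, and let $\theta(t)$ be the true anomaly of the Kepler elliptic orbit. Consider the Hamiltonian of the massless body $$H(P,q,t)=\frac12|P|^2-\sum_{i=1}^{N-1}\frac{m_i}{|r(\theta(t))R(\theta(t))a_i-q|},\qquad P,q\in\mathbb R^2 .$$ There exists a (time-dependent) symplectic coordinate change $(P,q)^T\mapsto(\bar Z,\bar z)^T$ such that, using the true anomaly $\theta$ as the independent variable, the resulting Hamiltonian function of the restricted $N$-body problem is $$H(\theta,\bar Z,\bar z)=\frac12|\bar Z|^2+\bar z\cdot J\bar Z+\frac{p-r(\theta)}{2p}|\bar z|^2-\frac{r(\theta)}{\sigma}\sum_{i=1}^{N-1}\frac{m_i}{|\sigma a_i-\bar z|},$$ where $\sigma=(\mu p)^{1/4}$.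
   Context: $J=\begin{pmatrix}0&-1\\1&0\end{pmatrix}$ and $R(\theta)=\begin{pmatrix}\cos\theta&-\sin\theta\\\sin\theta&\cos\theta\end{pmatrix}$. Hamilton's equations are $\dot P=-\partial H/\partial q$, $\dot q=\partial H/\partial P$ (and likewise, with $d/d\theta$, for $(\bar Z,\bar z)$). Normalized central configuration: the $a_i$ are pairwise distinct, $\sum_{i=1}^{N-1}m_i|a_i|^2=1$, $\mu=\sum_{1\le i<j\le N-1}\frac{m_im_j}{|a_i-a_j|}$ and $\sum_{j\ne i,\,1\le j\le N-1}\frac{m_j(a_j-a_i)}{|a_j-a_i|^3}=-\mu a_i$ for $1\le i\le N-1$. Kepler elliptic orbit: $r(t)=r(\theta(t))=\frac{p}{1+e\cos\theta(t)}$ with $p=a(1-e^2)$, $a>0$, satisfying $r^2\dot\theta=\sqrt{\mu p}=\sigma^2$ and $\ddot r=\mu\left(\frac{p}{r^3}-\frac1{r^2}\right)$. The primaries move as $r(\theta(t))R(\theta(t))a_i$, and the massless body at position $q$ does not affect them. *)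

theory Defs
  imports "HOL-Analysis.Analysis"
begin

type_synonym plane = "real^2"

text \<open>A phase point is a pair (momentum, position).\<close>
type_synonym phase = "plane \<times> plane"

definition J :: "real^2^2" where
  "J = vector [vector [0, -1], vector [1, 0]]"

definition R :: "real \<Rightarrow> real^2^2" where
  "R \<theta> = vector [vector [cos \<theta>, - sin \<theta>], vector [sin \<theta>, cos \<theta>]]"

text \<open>In the \<open>N\<close>-body problem the primaries are indexed by \<open>{1..<N}\<close>, i.e. by \<open>1, \<dots>, N-1\<close>.\<close>

definition normalized_central_configuration ::
  "nat \<Rightarrow> (nat \<Rightarrow> real) \<Rightarrow> (nat \<Rightarrow> plane) \<Rightarrow> real \<Rightarrow> bool" where
  "normalized_central_configuration N m a \<mu> \<longleftrightarrow>
     inj_on a {1..<N} \<and>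
     (\<Sum>i\<in>{1..<N}. m i * (norm (a i))\<^sup>2) = 1 \<and>
     \<mu> = (\<Sum>i\<in>{1..<N}. \<Sum>j\<in>{i<..<N}. m i * m j / norm (a i - a j)) \<and>
     (\<forall>i\<in>{1..<N}.
        (\<Sum>j\<in>{1..<N} - {i}. (m j / norm (a j - a i) ^ 3) *\<^sub>R (a j - a i)) = - (\<mu> *\<^sub>R a i))"

definition kepler_radius :: "real \<Rightarrow> real \<Rightarrow> real \<Rightarrow> real" where
  "kepler_radius p e \<theta> = p / (1 + e * cos \<theta>)"

text \<open>\<open>\<theta>\<close> is the true anomaly, as a real-valued (lifted) function of time \<open>t\<close>, of the
  Kepler elliptic orbit; \<open>A\<close> is the semi-major axis.\<close>

definition kepler_true_anomaly :: "real \<Rightarrow> real \<Rightarrow> real \<Rightarrow> (real \<Rightarrow> real) \<Rightarrow> bool" where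
  "kepler_true_anomaly \<mu> p e \<theta> \<longleftrightarrow>
     (\<exists>A>0. p = A * (1 - e\<^sup>2)) \<and>
     (\<exists>\<theta>'. \<forall>t. (\<theta> has_real_derivative \<theta>' t) (at t) \<and>
            (kepler_radius p e (\<theta> t))\<^sup>2 * \<theta>' t = sqrt (\<mu> * p)) \<and>
     (\<exists>r'. \<forall>t. ((\<lambda>s. kepler_radius p e (\<theta> s)) has_real_derivative r' t) (at t) \<and>
            (r' has_real_derivative
               \<mu> * (p / kepler_radius p e (\<theta> t) ^ 3 - 1 / (kepler_radius p e (\<theta> t))\<^sup>2)) (at t))"

text \<open>Phase space: all momenta, and all positions distinct from the positions \<open>b i\<close>.\<close>

definition collision_free :: "nat \<Rightarrow> (nat \<Rightarrow> plane) \<Rightarrow> phase set" where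
  "collision_free N b = {(P, q). \<forall>i\<in>{1..<N}. q \<noteq> b i}"

text \<open>Hamilton's equations \<open>P' = - \<partial>H/\<partial>q\<close>, \<open>q' = \<partial>H/\<partial>P\<close> on a set \<open>S\<close> of times, for a curve
  \<open>x = (P, q)\<close> in the (time-dependent) phase space \<open>D\<close>.\<close>

definition solves_hamilton ::
  "(real \<Rightarrow> phase set) \<Rightarrow> (real \<Rightarrow> plane \<Rightarrow> plane \<Rightarrow> real) \<Rightarrow> real set \<Rightarrow> (real \<Rightarrow> phase) \<Rightarrow> bool" where
  "solves_hamilton D H S x \<longleftrightarrow>
     (\<forall>t\<in>S. x t \<in> D t \<and>
        (\<exists>gP gq.
           GDERIV (\<lambda>P. H t P (snd (x t))) (fst (x t)) :> gP \<and>
           GDERIV (\<lambda>q. H t (fst (x t)) q) (snd (x t)) :> gq \<and>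
           (x has_vector_derivative (- gq, gP)) (at t)))"

definition symplectic_form :: "phase \<Rightarrow> phase \<Rightarrow> real" where
  "symplectic_form u v = fst u \<bullet> snd v - snd u \<bullet> fst v"

text \<open>A time-dependent symplectic coordinate change from \<open>D t\<close> onto \<open>E t\<close>: each \<open>\<Phi> t\<close> is a
  bijection, \<open>\<Phi>\<close> is jointly \<open>C\<^sup>1\<close> in time and phase point, and the phase-space part
  \<open>v \<mapsto> \<Phi>' (t, x) (0, v)\<close> of its derivative preserves the symplectic form. The latter
  part is therefore invertible, so on an open domain the inverse is automatically \<open>C\<^sup>1\<close> too.\<close>

definition symplectic_coordinate_change ::
  "(real \<Rightarrow> phase set) \<Rightarrow> (real \<Rightarrow> phase set) \<Rightarrow> (real \<Rightarrow> phase \<Rightarrow> phase) \<Rightarrow> bool" where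
  "symplectic_coordinate_change D E \<Phi> \<longleftrightarrow>
     (\<forall>t. bij_betw (\<Phi> t) (D t) (E t)) \<and>
     (\<exists>\<Phi>' :: real \<times> phase \<Rightarrow> (real \<times> phase) \<Rightarrow>\<^sub>L phase.
        continuous_on (SIGMA t:UNIV. D t) \<Phi>' \<and>
        (\<forall>t. \<forall>x\<in>D t.
           ((\<lambda>(s, y). \<Phi> s y) has_derivative blinfun_apply (\<Phi>' (t, x))) (at (t, x)) \<and>
           (\<forall>u v. symplectic_form (blinfun_apply (\<Phi>' (t, x)) (0, u)) (blinfun_apply (\<Phi>' (t, x)) (0, v))
                    = symplectic_form u v)))"

text \<open>\<open>\<Phi>\<close> together with the new independent variable \<open>\<tau> = \<theta> t\<close> turns the Hamiltonian system of
  \<open>H\<close> on \<open>D\<close> into that of \<open>K\<close> on \<open>E\<close>: a curve \<open>x\<close> in the old coordinates solves Hamilton's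
  equations iff its image \<open>w\<close>, reparametrized by \<open>\<tau>\<close>, does. For a symplectic \<open>\<Phi>\<close> this
  determines \<open>K\<close> up to a term that is locally constant on the phase space and so does not
  affect the equations of motion.\<close>

definition transforms_hamiltonian ::
  "(real \<Rightarrow> phase set) \<Rightarrow> (real \<Rightarrow> plane \<Rightarrow> plane \<Rightarrow> real) \<Rightarrow>
   (real \<Rightarrow> phase set) \<Rightarrow> (real \<Rightarrow> plane \<Rightarrow> plane \<Rightarrow> real) \<Rightarrow>
   (real \<Rightarrow> real) \<Rightarrow> (real \<Rightarrow> phase \<Rightarrow> phase) \<Rightarrow> bool" where
  "transforms_hamiltonian D H E K \<theta> \<Phi> \<longleftrightarrow>
     (\<forall>S x w. open S \<longrightarrow> connected S \<longrightarrow> (\<forall>t\<in>S. x t \<in> D t \<and> w (\<theta> t) = \<Phi> t (x t)) \<longrightarrow>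
        (solves_hamilton D H S x \<longleftrightarrow> solves_hamilton E K (\<theta> ` S) w))"

text \<open>The Hamiltonian of the massless body in inertial coordinates.\<close>

definition restricted_hamiltonian ::
  "nat \<Rightarrow> (nat \<Rightarrow> real) \<Rightarrow> (nat \<Rightarrow> plane) \<Rightarrow> real \<Rightarrow> real \<Rightarrow> (real \<Rightarrow> real)
     \<Rightarrow> real \<Rightarrow> plane \<Rightarrow> plane \<Rightarrow> real" where
  "restricted_hamiltonian N m a p e \<theta> t P q =
     (norm P)\<^sup>2 / 2
     - (\<Sum>i\<in>{1..<N}. m i / norm (kepler_radius p e (\<theta> t) *\<^sub>R (R (\<theta> t) *v a i) - q))"

definition reduced_hamiltonian ::
  "nat \<Rightarrow> (nat \<Rightarrow> real) \<Rightarrow> (nat \<Rightarrow> plane) \<Rightarrow> real \<Rightarrow> real \<Rightarrow> real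
     \<Rightarrow> real \<Rightarrow> plane \<Rightarrow> plane \<Rightarrow> real" where
  "reduced_hamiltonian N m a p e \<sigma> \<theta> Z z =
     (norm Z)\<^sup>2 / 2 + z \<bullet> (J *v Z)
     + (p - kepler_radius p e \<theta>) / (2 * p) * (norm z)\<^sup>2
     - kepler_radius p e \<theta> / \<sigma> * (\<Sum>i\<in>{1..<N}. m i / norm (\<sigma> *\<^sub>R a i - z))"

end

theory Submission
  imports Defs
begin

text \<open>Put \<open>\<alpha> = r / \<sigma>\<close> and pass to the pulsating, rotating frame
  \<open>q = \<alpha> R(\<theta>) z\<close>, in which the primaries rest at \<open>\<sigma> a\<^sub>i\<close>. Requiring that
  \<open>dz/d\<theta> = Z - J z\<close> forces \<open>P = \<alpha>\<^sup>-\<^sup>1 R(\<theta>) Z + \<alpha>' R(\<theta>) z\<close>; the second term is symmetric in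
  \<open>z\<close>, so the change is symplectic. Since \<open>\<theta>' = \<alpha>\<^sup>-\<^sup>2\<close>, the equation for \<open>Z\<close> then
  acquires the central force \<open>- \<alpha>\<^sup>3 \<alpha>'' z\<close>, and Kepler's equation gives
  \<open>\<alpha>\<^sup>3 \<alpha>'' = (p - r) / p\<close>.\<close>

section \<open>Rotations of the plane\<close>

lemma J_mult: "J *v x = vector [- (x $ 2), x $ 1]"
  by (simp add: J_def vec_eq_iff forall_2 matrix_vector_mult_def sum_2)

lemma J_J [simp]: "J *v (J *v x) = - x"
  by (simp add: J_mult vec_eq_iff forall_2)

lemma inner_J: "x \<bullet> (J *v y) = - ((J *v x) \<bullet> y)"
  by (simp add: J_mult inner_vec_def sum_2)

text \<open>\<open>J\<close> acts as multiplication by the imaginary unit and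
  \<open>R \<phi>\<close> as exp(i \<phi>). This form reduces the calculus of rotations to cos, sin
  and the identity \<open>J_J\<close>.\<close>

lemma R_mult: "R \<phi> *v x = cos \<phi> *\<^sub>R x + sin \<phi> *\<^sub>R (J *v x)"
  unfolding J_mult by (simp add: R_def vec_eq_iff forall_2 matrix_vector_mult_def sum_2)

lemma R_R: "R \<phi> *v (R \<psi> *v x) = R (\<phi> + \<psi>) *v x"
  by (simp add: R_mult cos_add sin_add algebra_simps)

lemma R_0 [simp]: "R 0 *v x = x"
  by (simp add: R_mult)

lemma inner_R [simp]: "(R \<phi> *v x) \<bullet> (R \<phi> *v y) = x \<bullet> y"
proof -
  \<comment> \<open>The Pythagorean identities are withheld from the simplifier here, so that both
    sides can be expanded to the same polynomial in cos and sin.\<close>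
  have "(R \<phi> *v x) \<bullet> (R \<phi> *v y) = ((cos \<phi>)\<^sup>2 + (sin \<phi>)\<^sup>2) * (x \<bullet> y)"
    unfolding R_mult J_mult inner_vec_def sum_2
    by (simp del: sin_cos_squared_add sin_cos_squared_add2) (simp only: power2_eq_square algebra_simps)
  then show ?thesis by simp
qed

lemma norm_R [simp]: "norm (R \<phi> *v x) = norm x"
  by (simp add: norm_eq_sqrt_inner)

text \<open>Product rule together with dR/d\<phi> = J R, which is read off from the cos/sin form of
  \<open>R\<close>.\<close>

lemma has_derivative_R [derivative_intros]:
  fixes f :: "'a::real_normed_vector \<Rightarrow> plane"
  assumes "(\<phi> has_derivative \<phi>') (at x within S)" "(f has_derivative f') (at x within S)"
  shows "((\<lambda>y. R (\<phi> y) *v f y) has_derivative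
    (\<lambda>h. R (\<phi> x) *v f' h + \<phi>' h *\<^sub>R (J *v (R (\<phi> x) *v f x)))) (at x within S)"
proof -
  have "((\<lambda>y. J *v f y) has_derivative (\<lambda>h. J *v f' h)) (at x within S)"
    using assms(2) by (rule bounded_linear.has_derivative[OF matrix_vector_mul_bounded_linear])
  then show ?thesis
    unfolding R_mult
    by (auto intro!: derivative_eq_intros assms simp: algebra_simps fun_eq_iff)
qed

lemma continuous_on_R [continuous_intros]:
  fixes f :: "'a::t2_space \<Rightarrow> plane"
  assumes "continuous_on S \<phi>" "continuous_on S f"
  shows "continuous_on S (\<lambda>x. R (\<phi> x) *v f x)"
  unfolding R_mult
  by (intro continuous_intros assms
      bounded_linear.continuous_on[OF matrix_vector_mul_bounded_linear])

section \<open>Hamiltonian vector fields\<close>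

lemma GDERIV_unique:
  assumes "GDERIV f x :> D" "GDERIV f x :> D'"
  shows "D = D'"
proof -
  have "(\<lambda>h. h \<bullet> D) = (\<lambda>h. h \<bullet> D')"
    using assms unfolding gderiv_def by (rule has_derivative_unique)
  then show ?thesis
    by (metis inner_commute vector_eq_rdot)
qed

text \<open>Gradients are unique, so the existentially quantified ones can be replaced by explicit
  fields. Hamilton's equations thereby become the flow of a concrete vector field.\<close>

lemma solves_hamilton_iff:
  assumes "\<And>t x. x \<in> D t \<Longrightarrow> GDERIV (\<lambda>P. H t P (snd x)) (fst x) :> gP t x"
    and "\<And>t x. x \<in> D t \<Longrightarrow> GDERIV (\<lambda>q. H t (fst x) q) (snd x) :> gq t x"
  shows "solves_hamilton D H S x \<longleftrightarrow>
    (\<forall>t\<in>S. x t \<in> D t \<and> (x has_vector_derivative (- gq t (x t), gP t (x t))) (at t))"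
  unfolding solves_hamilton_def using assms by (metis GDERIV_unique)

text \<open>One direction is the chain rule. For the other, positive speed makes \<theta> strictly
  increasing with a differentiable inverse, and composing with that inverse recovers
  \<open>w\<close>.\<close>

lemma has_vector_derivative_reparametrize:
  fixes \<theta> :: "real \<Rightarrow> real" and w :: "real \<Rightarrow> 'a::real_normed_vector"
  assumes \<theta>: "\<And>t. (\<theta> has_real_derivative \<omega> t) (at t)" and pos: "\<And>t. \<omega> t > 0"
  shows "(w has_vector_derivative y) (at (\<theta> t)) \<longleftrightarrow>
    ((\<lambda>s. w (\<theta> s)) has_vector_derivative \<omega> t *\<^sub>R y) (at t)"
proof
  assume "(w has_vector_derivative y) (at (\<theta> t))"
  from vector_diff_chain_at[OF \<theta>[unfolded has_real_derivative_iff_has_vector_derivative] this]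
  show "((\<lambda>s. w (\<theta> s)) has_vector_derivative \<omega> t *\<^sub>R y) (at t)"
    by (simp only: o_def)
next
  assume wt: "((\<lambda>s. w (\<theta> s)) has_vector_derivative \<omega> t *\<^sub>R y) (at t)"
  have "strict_mono \<theta>"
    by (rule strict_monoI, erule DERIV_pos_imp_increasing) (use \<theta> pos in blast)
  then have inj: "inj \<theta>"
    by (rule strict_mono_imp_inj_on)
  have cont: "continuous_on UNIV \<theta>"
    using \<theta> by (meson DERIV_isCont continuous_at_imp_continuous_on)
  \<comment> \<open>\<open>inv \<theta>\<close> is a right inverse only on the range. Openness makes
    \<open>w\<close> agree with the composite on a neighbourhood of \<open>\<theta> t\<close>, as a
    two-sided derivative there requires.\<close>
  have "open (range \<theta>)"
    using cont inj injective_eq_1d_open_map_UNIV by blast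
  have "(inv \<theta> has_derivative (\<lambda>h. h / \<omega> t)) (at (\<theta> t))"
    by (rule has_derivative_inverse_strong[where S = UNIV and f' = "(*) (\<omega> t)"])
      (use \<theta>[of t] pos[of t] cont inj in \<open>simp_all add: has_field_derivative_def fun_eq_iff\<close>)
  then have "(inv \<theta> has_vector_derivative (1 / \<omega> t)) (at (\<theta> t))"
    by (simp add: has_vector_derivative_def)
  then have "((\<lambda>s. w (\<theta> s)) \<circ> inv \<theta> has_vector_derivative (1 / \<omega> t) *\<^sub>R \<omega> t *\<^sub>R y) (at (\<theta> t))"
    by (rule vector_diff_chain_at) (simp add: inj wt)
  then have "((\<lambda>s. w (\<theta> s)) \<circ> inv \<theta> has_vector_derivative y) (at (\<theta> t))"
    using pos[of t] by simp
  then show "(w has_vector_derivative y) (at (\<theta> t))"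
    by (rule has_vector_derivative_transform_within_open[OF _ \<open>open (range \<theta>)\<close>])
      (auto simp: f_inv_into_f)
qed

text \<open>Chain rule along the graph of \<open>x\<close> in extended phase space; the entry 1 is
  the speed of time itself.\<close>

lemma has_vector_derivative_along:
  fixes \<Phi> :: "real \<Rightarrow> 'a::real_normed_vector \<Rightarrow> 'b::real_normed_vector"
  assumes "((\<lambda>(s, y). \<Phi> s y) has_derivative \<Phi>') (at (t, x t))"
    and "(x has_vector_derivative v) (at t)"
  shows "((\<lambda>s. \<Phi> s (x s)) has_vector_derivative \<Phi>' (1, v)) (at t)"
proof -
  have "((\<lambda>s. (s, x s)) has_vector_derivative (1, v)) (at t)"
    using assms(2) by (intro has_vector_derivative_Pair) auto
  then have "((\<lambda>(s, y). \<Phi> s y) \<circ> (\<lambda>s. (s, x s)) has_vector_derivative \<Phi>' (1, v)) (at t)"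
    by (rule vector_derivative_diff_chain_within) (rule has_derivative_at_withinI[OF assms(1)])
  then show ?thesis by (simp add: o_def)
qed

text \<open>Testing against \<open>(0, fst u)\<close> and \<open>(snd u, 0)\<close> gives the
  squared norms of both components up to sign. Hence a linear map preserving the form is
  injective.\<close>

lemma symplectic_form_nondegenerate:
  assumes "\<And>v. symplectic_form u v = 0"
  shows "u = 0"
proof -
  have "fst u \<bullet> fst u = 0" "snd u \<bullet> snd u = 0"
    using assms[of "(0, fst u)"] assms[of "(snd u, 0)"] by (auto simp: symplectic_form_def)
  then show ?thesis by (simp add: prod_eq_iff)
qed

text \<open>The criterion \<open>field\<close> says that the derivative of \<Phi> carries the
  extended Hamiltonian field of \<open>H\<close> to \<omega> times the field of \<open>K\<close>,
  where \<omega> is the speed of the new time. Solutions of \<open>H\<close> then map forward by the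
  chain rule. Conversely, \<Psi> makes \<open>x\<close> differentiable, and
  \<open>symplectic\<close> determines its velocity.\<close>

lemma transforms_hamiltonianI:
  fixes \<Phi> \<Psi> :: "real \<Rightarrow> phase \<Rightarrow> phase" and \<theta> :: "real \<Rightarrow> real"
  assumes \<theta>: "\<And>t. (\<theta> has_real_derivative \<omega> t) (at t)" and pos: "\<And>t. \<omega> t > 0"
    and H: "\<And>t x. x \<in> D t \<Longrightarrow> GDERIV (\<lambda>P. H t P (snd x)) (fst x) :> HP t x"
      "\<And>t x. x \<in> D t \<Longrightarrow> GDERIV (\<lambda>q. H t (fst x) q) (snd x) :> Hq t x"
    and K: "\<And>\<tau> y. y \<in> E \<Longrightarrow> GDERIV (\<lambda>Z. K \<tau> Z (snd y)) (fst y) :> KZ \<tau> y"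
      "\<And>\<tau> y. y \<in> E \<Longrightarrow> GDERIV (\<lambda>z. K \<tau> (fst y) z) (snd y) :> Kz \<tau> y"
    and map: "\<And>t x. x \<in> D t \<Longrightarrow> \<Phi> t x \<in> E"
    and inverse: "\<And>t x. x \<in> D t \<Longrightarrow> \<Psi> t (\<Phi> t x) = x"
    and \<Psi>: "\<And>t y. (\<lambda>(s, y). \<Psi> s y) differentiable (at (t, y))"
    and \<Phi>: "\<And>t x. x \<in> D t \<Longrightarrow> ((\<lambda>(s, y). \<Phi> s y) has_derivative \<Phi>' t x) (at (t, x))"
    and symplectic: "\<And>t x u v. x \<in> D t \<Longrightarrow>
      symplectic_form (\<Phi>' t x (0, u)) (\<Phi>' t x (0, v)) = symplectic_form u v"
    and field: "\<And>t x. x \<in> D t \<Longrightarrow>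
      \<Phi>' t x (1, - Hq t x, HP t x) = \<omega> t *\<^sub>R (- Kz (\<theta> t) (\<Phi> t x), KZ (\<theta> t) (\<Phi> t x))"
  shows "transforms_hamiltonian D H (\<lambda>_. E) K \<theta> \<Phi>"
  unfolding transforms_hamiltonian_def
proof (intro allI impI)
  fix S :: "real set" and x w :: "real \<Rightarrow> phase"
  assume S: "open S" and xw: "\<forall>t\<in>S. x t \<in> D t \<and> w (\<theta> t) = \<Phi> t (x t)"
  have iff: "(x has_vector_derivative (- Hq t (x t), HP t (x t))) (at t) \<longleftrightarrow>
      (w has_vector_derivative (- Kz (\<theta> t) (w (\<theta> t)), KZ (\<theta> t) (w (\<theta> t)))) (at (\<theta> t))"
    if t: "t \<in> S" for t
  proof -
    let ?X = "(- Hq t (x t), HP t (x t))"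
    have x: "x t \<in> D t" and w: "w (\<theta> t) = \<Phi> t (x t)"
      using xw t by auto
    have "(x has_vector_derivative ?X) (at t) \<longleftrightarrow>
      ((\<lambda>s. w (\<theta> s)) has_vector_derivative \<Phi>' t (x t) (1, ?X)) (at t)"
    proof
      assume "(x has_vector_derivative ?X) (at t)"
      from has_vector_derivative_along[where x = x, OF \<Phi>[OF x] this]
      show "((\<lambda>s. w (\<theta> s)) has_vector_derivative \<Phi>' t (x t) (1, ?X)) (at t)"
        by (rule has_vector_derivative_transform_within_open[OF _ S t]) (use xw in auto)
    next
      assume w': "((\<lambda>s. w (\<theta> s)) has_vector_derivative \<Phi>' t (x t) (1, ?X)) (at t)"
      \<comment> \<open>On \<open>S\<close> the curve \<open>x\<close> is \<Psi> applied to
        \<open>w (\<theta> s)\<close>, so it has some velocity \<open>v\<close>, which remains to be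
        identified with \<open>?X\<close>.\<close>
      obtain \<Psi>' where "((\<lambda>(s, y). \<Psi> s y) has_derivative \<Psi>') (at (t, w (\<theta> t)))"
        using \<Psi> unfolding differentiable_def by blast
      from has_vector_derivative_along[where x = "\<lambda>s. w (\<theta> s)", OF this w']
      obtain v where "((\<lambda>s. \<Psi> s (w (\<theta> s))) has_vector_derivative v) (at t)"
        by blast
      then have v: "(x has_vector_derivative v) (at t)"
        by (rule has_vector_derivative_transform_within_open[OF _ S t]) (use xw inverse in auto)
      have "((\<lambda>s. w (\<theta> s)) has_vector_derivative \<Phi>' t (x t) (1, v)) (at t)"
        by (rule has_vector_derivative_transform_within_open
            [OF has_vector_derivative_along[where x = x, OF \<Phi>[OF x] v] S t]) (use xw in auto)
      then have eq: "\<Phi>' t (x t) (1, v) = \<Phi>' t (x t) (1, ?X)"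
        using w' by (rule vector_derivative_unique_at)
      have "linear (\<Phi>' t (x t))"
        using \<Phi>[OF x] by (rule has_derivative_linear)
      \<comment> \<open>The time components of the two extended velocities agree, so their
        difference is a pure phase direction, where the symplectic form is preserved.\<close>
      then have "\<Phi>' t (x t) (0, v - ?X) = 0"
        using eq linear_diff[of "\<Phi>' t (x t)" "(1, v)" "(1, ?X)"] by simp
      then have "symplectic_form (v - ?X) u = 0" for u
        using symplectic[OF x, of "v - ?X" u] by (simp add: symplectic_form_def)
      then have "v - ?X = 0"
        by (rule symplectic_form_nondegenerate)
      then show "(x has_vector_derivative ?X) (at t)"
        using v by simp
    qed
    also have "\<Phi>' t (x t) (1, ?X) = \<omega> t *\<^sub>R (- Kz (\<theta> t) (w (\<theta> t)), KZ (\<theta> t) (w (\<theta> t)))"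
      using field[OF x] w by simp
    finally show ?thesis
      by (simp only: has_vector_derivative_reparametrize[OF \<theta> pos])
  qed
  have mem: "x t \<in> D t" "w (\<theta> t) \<in> E" if "t \<in> S" for t
    using that xw map by auto
  have solves_H: "solves_hamilton D H S x \<longleftrightarrow>
      (\<forall>t\<in>S. x t \<in> D t \<and> (x has_vector_derivative (- Hq t (x t), HP t (x t))) (at t))"
    by (rule solves_hamilton_iff) (fact H)+
  have solves_K: "solves_hamilton (\<lambda>_. E) K (\<theta> ` S) w \<longleftrightarrow>
      (\<forall>\<tau>\<in>\<theta> ` S. w \<tau> \<in> E \<and> (w has_vector_derivative (- Kz \<tau> (w \<tau>), KZ \<tau> (w \<tau>))) (at \<tau>))"
    by (rule solves_hamilton_iff) (fact K)+
  show "solves_hamilton D H S x \<longleftrightarrow> solves_hamilton (\<lambda>_. E) K (\<theta> ` S) w"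
    unfolding solves_H solves_K by (simp add: mem iff)
qed

section \<open>Gradients of the two Hamiltonians\<close>

text \<open>The minus sign from differentiating \<open>b - q\<close> cancels the one from
  differentiating the reciprocal, so the gradient points towards \<open>b\<close> when
  \<open>c\<close> is positive.\<close>

lemma GDERIV_newton_potential:
  fixes b q :: "'a::real_inner"
  assumes "q \<noteq> b"
  shows "GDERIV (\<lambda>q. c / norm (b - q)) q :> (c / norm (b - q) ^ 3) *\<^sub>R (b - q)"
proof -
  have nz: "norm (b - q) \<noteq> 0" using assms by simp
  have "((\<lambda>q. b - q) has_derivative (\<lambda>h. - h)) (at q)"
    by (auto intro!: derivative_eq_intros)
  then have "((\<lambda>q. norm (b - q)) has_derivative (\<lambda>h. (- h) \<bullet> sgn (b - q))) (at q)"
    using assms by (intro has_derivative_compose[OF _ GDERIV_norm[unfolded gderiv_def]]) auto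
  from has_derivative_divide[OF has_derivative_const this nz] show ?thesis
    unfolding gderiv_def
    by (rule has_derivative_eq_rhs) (simp add: fun_eq_iff sgn_div_norm power3_eq_cube divide_simps)
qed

text \<open>For positive masses this is the attraction of primaries at \<open>b i\<close>: the
  gradient of the positive sum that both Hamiltonians subtract, up to a factor.\<close>

definition newton_force :: "nat \<Rightarrow> (nat \<Rightarrow> real) \<Rightarrow> (nat \<Rightarrow> plane) \<Rightarrow> plane \<Rightarrow> plane" where
  "newton_force N m b q = (\<Sum>i\<in>{1..<N}. (m i / norm (b i - q) ^ 3) *\<^sub>R (b i - q))"

lemma has_derivative_newton_potential:
  assumes "(P, q) \<in> collision_free N b"
  shows "((\<lambda>q. \<Sum>i\<in>{1..<N}. m i / norm (b i - q)) has_derivative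
    (\<lambda>h. h \<bullet> newton_force N m b q)) (at q)"
  unfolding newton_force_def inner_sum_right
  by (intro has_derivative_sum GDERIV_newton_potential[unfolded gderiv_def])
    (use assms in \<open>auto simp: collision_free_def\<close>)

text \<open>The inverse-square law is homogeneous of degree -2 and commutes with rotations: each
  summand has one factor \<open>k\<close> above and \<open>k ^ 3\<close> below.\<close>

lemma newton_force_similarity:
  assumes "k > 0"
  shows "newton_force N m (\<lambda>i. k *\<^sub>R (R \<phi> *v b i)) (k *\<^sub>R (R \<phi> *v q))
    = (1 / k\<^sup>2) *\<^sub>R (R \<phi> *v newton_force N m b q)"
proof -
  have "(c / norm (k *\<^sub>R (R \<phi> *v x) - k *\<^sub>R (R \<phi> *v q)) ^ 3) *\<^sub>R
      (k *\<^sub>R (R \<phi> *v x) - k *\<^sub>R (R \<phi> *v q))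
    = (1 / k\<^sup>2) *\<^sub>R (R \<phi> *v ((c / norm (x - q) ^ 3) *\<^sub>R (x - q)))" for c x
  proof -
    have "k *\<^sub>R (R \<phi> *v x) - k *\<^sub>R (R \<phi> *v q) = k *\<^sub>R (R \<phi> *v (x - q))"
      by (simp only: matrix_vector_mult_diff_distrib scaleR_diff_right)
    moreover have "c / (k * norm (x - q)) ^ 3 * k = 1 / k\<^sup>2 * (c / norm (x - q) ^ 3)"
      using assms by (simp add: power2_eq_square power3_eq_cube)
    ultimately show ?thesis
      using assms by (simp only: norm_scaleR norm_R scaleR_scaleR matrix_vector_mult_scaleR abs_of_pos)
  qed
  then show ?thesis
    unfolding newton_force_def
    by (simp only: linear_sum[OF matrix_vector_mul_linear] scaleR_sum_right)
qed

lemma has_derivative_half_norm_squared: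
  "((\<lambda>x::'a::real_inner. (norm x)\<^sup>2 / 2) has_derivative (\<lambda>h. h \<bullet> x)) (at x)"
  unfolding power2_norm_eq_inner
  by (auto intro!: derivative_eq_intros simp: fun_eq_iff inner_commute)

lemma GDERIV_restricted_hamiltonian:
  assumes "x \<in> collision_free N (\<lambda>i. kepler_radius p e (\<theta> t) *\<^sub>R (R (\<theta> t) *v a i))"
  shows "GDERIV (\<lambda>P. restricted_hamiltonian N m a p e \<theta> t P (snd x)) (fst x) :> fst x"
    and "GDERIV (\<lambda>q. restricted_hamiltonian N m a p e \<theta> t (fst x) q) (snd x) :>
      - newton_force N m (\<lambda>i. kepler_radius p e (\<theta> t) *\<^sub>R (R (\<theta> t) *v a i)) (snd x)"
proof -
  have x: "(fst x, snd x) \<in> collision_free N (\<lambda>i. kepler_radius p e (\<theta> t) *\<^sub>R (R (\<theta> t) *v a i))"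
    using assms by simp
  show "GDERIV (\<lambda>P. restricted_hamiltonian N m a p e \<theta> t P (snd x)) (fst x) :> fst x"
    unfolding gderiv_def restricted_hamiltonian_def
    by (rule has_derivative_eq_rhs,
        (rule has_derivative_diff has_derivative_half_norm_squared has_derivative_const)+) simp
  show "GDERIV (\<lambda>q. restricted_hamiltonian N m a p e \<theta> t (fst x) q) (snd x) :>
      - newton_force N m (\<lambda>i. kepler_radius p e (\<theta> t) *\<^sub>R (R (\<theta> t) *v a i)) (snd x)"
    unfolding gderiv_def restricted_hamiltonian_def
    by (rule has_derivative_eq_rhs,
        (rule has_derivative_diff has_derivative_const has_derivative_newton_potential[OF x])+) simp
qed

text \<open>The coupling of \<open>z\<close> with \<open>J *v Z\<close> is linear in each variable.
  Skewness of \<open>J\<close> (\<open>inner_J\<close>) moves it onto \<open>z\<close>, whence the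
  opposite signs of the \<open>J\<close> terms in the two gradients.\<close>

lemma GDERIV_reduced_hamiltonian:
  assumes "y \<in> collision_free N (\<lambda>i. \<sigma> *\<^sub>R a i)"
  shows "GDERIV (\<lambda>Z. reduced_hamiltonian N m a p e \<sigma> \<tau> Z (snd y)) (fst y) :>
      fst y - J *v snd y"
    and "GDERIV (\<lambda>z. reduced_hamiltonian N m a p e \<sigma> \<tau> (fst y) z) (snd y) :>
      J *v fst y + ((p - kepler_radius p e \<tau>) / p) *\<^sub>R snd y
        - (kepler_radius p e \<tau> / \<sigma>) *\<^sub>R newton_force N m (\<lambda>i. \<sigma> *\<^sub>R a i) (snd y)"
proof -
  have eq: "(p - r) / (2 * p) * (norm z)\<^sup>2 = (p - r) / p * ((norm z)\<^sup>2 / 2)"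
    for r and z :: plane by simp
  have y: "(fst y, snd y) \<in> collision_free N (\<lambda>i. \<sigma> *\<^sub>R a i)"
    using assms by simp
  show "GDERIV (\<lambda>Z. reduced_hamiltonian N m a p e \<sigma> \<tau> Z (snd y)) (fst y) :>
      fst y - J *v snd y"
    unfolding gderiv_def reduced_hamiltonian_def inner_J
    by (rule has_derivative_eq_rhs,
        (rule has_derivative_diff has_derivative_add has_derivative_minus
          has_derivative_inner_right has_derivative_ident has_derivative_const
          has_derivative_half_norm_squared)+)
      (simp add: fun_eq_iff inner_diff_right inner_commute)
  show "GDERIV (\<lambda>z. reduced_hamiltonian N m a p e \<sigma> \<tau> (fst y) z) (snd y) :>
      J *v fst y + ((p - kepler_radius p e \<tau>) / p) *\<^sub>R snd y
        - (kepler_radius p e \<tau> / \<sigma>) *\<^sub>R newton_force N m (\<lambda>i. \<sigma> *\<^sub>R a i) (snd y)"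
    unfolding gderiv_def reduced_hamiltonian_def eq
    by (rule has_derivative_eq_rhs,
        (rule has_derivative_diff has_derivative_add has_derivative_mult_right
          has_derivative_inner_left has_derivative_ident has_derivative_const
          has_derivative_half_norm_squared has_derivative_newton_potential[OF y])+)
      (simp add: fun_eq_iff inner_diff_right inner_add_right)
qed

section \<open>The pulsating rotating frame\<close>

text \<open>\<alpha> is the scale, \<beta> is meant as its time derivative and \<phi> as the angle
  of the frame. The \<beta> term is the shear of the momentum that compensates for the
  pulsation.\<close>

definition pulsating_frame ::
  "(real \<Rightarrow> real) \<Rightarrow> (real \<Rightarrow> real) \<Rightarrow> (real \<Rightarrow> real) \<Rightarrow> real \<Rightarrow> phase \<Rightarrow> phase" where
  "pulsating_frame \<alpha> \<beta> \<phi> t x =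
     (R (- \<phi> t) *v (\<alpha> t *\<^sub>R fst x - \<beta> t *\<^sub>R snd x), R (- \<phi> t) *v (inverse (\<alpha> t) *\<^sub>R snd x))"

definition inertial_frame ::
  "(real \<Rightarrow> real) \<Rightarrow> (real \<Rightarrow> real) \<Rightarrow> (real \<Rightarrow> real) \<Rightarrow> real \<Rightarrow> phase \<Rightarrow> phase" where
  "inertial_frame \<alpha> \<beta> \<phi> t y =
     (R (\<phi> t) *v (inverse (\<alpha> t) *\<^sub>R fst y + \<beta> t *\<^sub>R snd y), R (\<phi> t) *v (\<alpha> t *\<^sub>R snd y))"

text \<open>Candidate total derivative at \<open>(t, P, q)\<close> in the direction
  \<open>(s, u, v)\<close>; terms with \<open>s\<close> come from the explicit time dependence, with
  \<gamma> in the role of the derivative of \<beta>.\<close>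

definition pulsating_frame_deriv ::
  "(real \<Rightarrow> real) \<Rightarrow> (real \<Rightarrow> real) \<Rightarrow> (real \<Rightarrow> real) \<Rightarrow> (real \<Rightarrow> real) \<Rightarrow> (real \<Rightarrow> real)
     \<Rightarrow> real \<times> phase \<Rightarrow> real \<times> phase \<Rightarrow> phase" where
  "pulsating_frame_deriv \<alpha> \<beta> \<gamma> \<phi> \<omega> = (\<lambda>(t, P, q) (s, u, v).
     (R (- \<phi> t) *v (\<alpha> t *\<^sub>R u + (s * \<beta> t) *\<^sub>R P - \<beta> t *\<^sub>R v - (s * \<gamma> t) *\<^sub>R q)
        - (s * \<omega> t) *\<^sub>R (J *v (R (- \<phi> t) *v (\<alpha> t *\<^sub>R P - \<beta> t *\<^sub>R q))),
      R (- \<phi> t) *v (inverse (\<alpha> t) *\<^sub>R v - (s * \<beta> t / (\<alpha> t)\<^sup>2) *\<^sub>R q)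
        - (s * \<omega> t) *\<^sub>R (J *v (R (- \<phi> t) *v (inverse (\<alpha> t) *\<^sub>R q)))))"

lemma inertial_pulsating_frame:
  assumes "\<alpha> t \<noteq> 0"
  shows "inertial_frame \<alpha> \<beta> \<phi> t (pulsating_frame \<alpha> \<beta> \<phi> t x) = x"
    and "pulsating_frame \<alpha> \<beta> \<phi> t (inertial_frame \<alpha> \<beta> \<phi> t x) = x"
  using assms
  by (simp_all add: inertial_frame_def pulsating_frame_def prod_eq_iff R_R
      flip: matrix_vector_mult_scaleR)
    (simp_all add: matrix_vector_mult_scaleR matrix_vector_right_distrib
      matrix_vector_mult_diff_distrib R_R algebra_simps)

lemma has_derivative_compose_fst:
  assumes "(f has_real_derivative D) (at (fst z))"
  shows "((\<lambda>z. f (fst z)) has_derivative (\<lambda>h. fst h * D)) (at z)"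
  using has_derivative_compose[OF bounded_linear_imp_has_derivative[OF bounded_linear_fst]
      assms[unfolded has_field_derivative_def]]
  by (simp add: mult.commute)

context
  fixes \<alpha> \<beta> \<gamma> \<phi> \<omega> :: "real \<Rightarrow> real"
  assumes \<alpha>: "\<And>t. (\<alpha> has_real_derivative \<beta> t) (at t)"
    and \<beta>: "\<And>t. (\<beta> has_real_derivative \<gamma> t) (at t)"
    and \<phi>: "\<And>t. (\<phi> has_real_derivative \<omega> t) (at t)"
    and \<alpha>_nz: "\<And>t. \<alpha> t \<noteq> 0"
begin

lemma has_derivative_pulsating_frame:
  "((\<lambda>(s, y). pulsating_frame \<alpha> \<beta> \<phi> s y) has_derivative
    pulsating_frame_deriv \<alpha> \<beta> \<gamma> \<phi> \<omega> z) (at z)"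
  unfolding pulsating_frame_def case_prod_beta
  by (rule derivative_eq_intros has_derivative_compose_fst \<alpha> \<beta> \<phi> \<alpha>_nz refl
      | simp add: pulsating_frame_deriv_def case_prod_beta fun_eq_iff
        power2_eq_square algebra_simps divide_simps \<alpha>_nz)+

lemma differentiable_inertial_frame:
  "(\<lambda>(s, y). inertial_frame \<alpha> \<beta> \<phi> s y) differentiable (at z)"
  unfolding inertial_frame_def case_prod_beta differentiable_def
  by (rule exI) (rule derivative_intros has_derivative_compose_fst \<alpha> \<beta> \<phi> \<alpha>_nz)+

text \<open>In phase directions the derivative is a common rotation after (u, v) -> (\<alpha> u -
  \<beta> v, v / \<alpha>). The scalings cancel in the pairing, and the \<beta> terms cancel because
  the inner product is symmetric.\<close>

lemma symplectic_pulsating_frame_deriv: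
  "symplectic_form (pulsating_frame_deriv \<alpha> \<beta> \<gamma> \<phi> \<omega> z (0, u))
     (pulsating_frame_deriv \<alpha> \<beta> \<gamma> \<phi> \<omega> z (0, v)) = symplectic_form u v"
  using \<alpha>_nz[of "fst z"]
  by (simp add: pulsating_frame_deriv_def case_prod_beta symplectic_form_def
      inner_diff_left inner_diff_right inner_commute field_simps)

lemma symplectic_coordinate_change_pulsating_frame:
  assumes "continuous_on UNIV \<gamma>" "continuous_on UNIV \<omega>"
    and "\<And>t. bij_betw (pulsating_frame \<alpha> \<beta> \<phi> t) (D t) (E t)"
  shows "symplectic_coordinate_change D E (pulsating_frame \<alpha> \<beta> \<phi>)"
proof -
  let ?d = "pulsating_frame_deriv \<alpha> \<beta> \<gamma> \<phi> \<omega>"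
  have apply_d: "blinfun_apply (Blinfun (?d z)) = ?d z" for z
    using has_derivative_pulsating_frame[of z]
    by (intro bounded_linear_Blinfun_apply has_derivative_bounded_linear)
  have "continuous_on UNIV \<alpha>" "continuous_on UNIV \<beta>" "continuous_on UNIV \<phi>"
    using \<alpha> \<beta> \<phi> by (meson DERIV_isCont continuous_at_imp_continuous_on)+
  then have "continuous_on UNIV (\<lambda>z :: real \<times> phase. f (fst z))"
    if "f \<in> {\<alpha>, \<beta>, \<gamma>, \<phi>, \<omega>}" for f
    using that assms by (auto intro!: continuous_on_compose2[where f = fst] continuous_intros)
  then have cont: "continuous_on UNIV (\<lambda>z. ?d z h)" for h
    unfolding pulsating_frame_deriv_def case_prod_beta
    by (intro continuous_intros bounded_linear.continuous_on[OF matrix_vector_mul_bounded_linear])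
      (auto simp: \<alpha>_nz)
  \<comment> \<open>On a finite-dimensional domain, continuity in operator norm follows from
    continuity for each fixed direction.\<close>
  have "continuous_on A (\<lambda>z. Blinfun (?d z))" for A
    by (rule continuous_on_blinfun_componentwise)
      (simp only: apply_d continuous_on_subset[OF cont subset_UNIV])
  then show ?thesis
    unfolding symplectic_coordinate_change_def
    using assms has_derivative_pulsating_frame symplectic_pulsating_frame_deriv
    by (intro conjI exI[of _ "\<lambda>z. Blinfun (?d z)"]) (auto simp: apply_d)
qed

end

section \<open>The restricted problem\<close>

text \<open>Distinct positions and positive masses make every summand positive, and
  \<open>N \<ge> 3\<close> supplies at least the pair (1, 2).\<close>

lemma central_configuration_constant_pos:
  assumes "N \<ge> 3" and m: "\<And>i. i \<in> {1..<N} \<Longrightarrow> m i > 0"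
    and cc: "normalized_central_configuration N m a \<mu>"
  shows "\<mu> > 0"
proof -
  have inj: "inj_on a {1..<N}"
    and \<mu>: "\<mu> = (\<Sum>i\<in>{1..<N}. \<Sum>j\<in>{i<..<N}. m i * m j / norm (a i - a j))"
    using cc by (auto simp: normalized_central_configuration_def)
  have pos: "m i * m j / norm (a i - a j) > 0" if "i \<in> {1..<N}" "j \<in> {i<..<N}" for i j
    using that m inj by (auto simp: inj_on_eq_iff)
  have 1: "1 \<in> {1..<N}" and 2: "2 \<in> {1<..<N}"
    using \<open>N \<ge> 3\<close> by auto
  have "0 < (\<Sum>j\<in>{1<..<N}. m 1 * m j / norm (a 1 - a j))"
    using 2 by (intro sum_pos pos[OF 1]) blast+
  then show ?thesis
    unfolding \<mu>
    by (rule sum_pos2[OF finite_atLeastLessThan 1]) (intro sum_nonneg less_imp_le pos)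
qed

theorem proposition2p1:
  fixes N :: nat and m :: "nat \<Rightarrow> real" and a :: "nat \<Rightarrow> plane"
    and \<mu> p e \<sigma> :: real and \<theta> :: "real \<Rightarrow> real"
  assumes "N \<ge> 3"
    and "\<And>i. i \<in> {1..<N} \<Longrightarrow> m i > 0"
    and "normalized_central_configuration N m a \<mu>"
    and "0 \<le> e" and "e < 1" and "p > 0"
    and "kepler_true_anomaly \<mu> p e \<theta>"
    and "\<sigma> = (\<mu> * p) powr (1/4)"
  defines "D \<equiv> \<lambda>t. collision_free N (\<lambda>i. kepler_radius p e (\<theta> t) *\<^sub>R (R (\<theta> t) *v a i))"
    and "E \<equiv> collision_free N (\<lambda>i. \<sigma> *\<^sub>R a i)"
  shows "\<exists>\<Phi> :: real \<Rightarrow> phase \<Rightarrow> phase.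
    symplectic_coordinate_change D (\<lambda>_. E) \<Phi> \<and>
    transforms_hamiltonian
      D (restricted_hamiltonian N m a p e \<theta>)
      (\<lambda>_. E) (reduced_hamiltonian N m a p e \<sigma>)
      \<theta> \<Phi>"
proof -
  have \<mu>: "\<mu> > 0"
    using assms(1-3) by (rule central_configuration_constant_pos)
  then have \<sigma>: "\<sigma> > 0" and \<sigma>4: "\<sigma> ^ 4 = \<mu> * p"
    using assms(6,8) by (auto simp: powr_power)
  \<comment> \<open>This turns the areal constant of the Kepler orbit into the square of
    \<sigma>.\<close>
  have \<sigma>2: "sqrt (\<mu> * p) = \<sigma>\<^sup>2"
    using \<sigma>4 by (intro real_sqrt_unique) auto
  define r where "r t = kepler_radius p e (\<theta> t)" for t
  have r: "r t > 0" for t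
  proof -
    have "\<bar>e * cos (\<theta> t)\<bar> < 1"
      using assms(4,5) mult_left_le[of "\<bar>cos (\<theta> t)\<bar>" e] by (simp add: abs_mult)
    then show ?thesis
      using assms(6) by (simp add: r_def kepler_radius_def)
  qed
  obtain \<theta>' r' where \<theta>: "\<And>t. (\<theta> has_real_derivative \<theta>' t) (at t)"
    and \<theta>'_eq: "\<And>t. (r t)\<^sup>2 * \<theta>' t = \<sigma>\<^sup>2"
    and r': "\<And>t. (r has_real_derivative r' t) (at t)"
    and r'': "\<And>t. (r' has_real_derivative \<mu> * (p / r t ^ 3 - 1 / (r t)\<^sup>2)) (at t)"
    using assms(7) unfolding kepler_true_anomaly_def \<sigma>2 r_def by blast
  \<comment> \<open>Dividing by \<sigma> makes \<alpha> take the fixed points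
    \<open>\<sigma> *\<^sub>R a i\<close> to the primaries after rotation. \<beta> and \<gamma> are
    the first two time derivatives of \<alpha>, the second from Kepler's radial equation; \<omega>
    will be the angular speed, by the area law.\<close>
  define \<alpha> \<beta> \<gamma> \<omega> where "\<alpha> t = r t / \<sigma>" and "\<beta> t = r' t / \<sigma>"
    and "\<gamma> t = \<mu> * (p / r t ^ 3 - 1 / (r t)\<^sup>2) / \<sigma>" and "\<omega> t = 1 / (\<alpha> t)\<^sup>2" for t
  have \<alpha>_pos: "\<alpha> t > 0" for t
    using r \<sigma> by (simp add: \<alpha>_def)
  have \<alpha>: "(\<alpha> has_real_derivative \<beta> t) (at t)" for t
    unfolding \<alpha>_def \<beta>_def using r' by (rule DERIV_cdivide)
  have \<beta>: "(\<beta> has_real_derivative \<gamma> t) (at t)" for t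
    unfolding \<beta>_def \<gamma>_def using r'' by (rule DERIV_cdivide)
  have "\<theta>' t = \<omega> t" for t
    using \<theta>'_eq[of t] r[of t] \<sigma> by (simp add: \<omega>_def \<alpha>_def field_simps)
  then have \<theta>: "(\<theta> has_real_derivative \<omega> t) (at t)" for t
    using \<theta> by metis
  \<comment> \<open>This produces the coefficient of the quadratic term in the reduced Hamiltonian:
    \<gamma> \<alpha> is the central force from the pulsation, measured against the angular
    speed.\<close>
  have \<gamma>\<alpha>: "\<gamma> t * \<alpha> t = \<omega> t * ((p - r t) / p)" for t
  proof -
    have "\<gamma> t * \<alpha> t = (\<mu> / \<sigma>\<^sup>2) * ((p - r t) / (r t)\<^sup>2)"
      using r[of t] \<sigma> by (simp add: \<gamma>_def \<alpha>_def power2_eq_square power3_eq_cube field_simps)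
    also have "\<mu> / \<sigma>\<^sup>2 = \<sigma>\<^sup>2 / p"
      using \<sigma>4 \<sigma> assms(6) by (simp add: field_simps flip: power_add)
    finally show ?thesis
      by (simp add: \<omega>_def \<alpha>_def power_divide)
  qed
  let ?\<Phi> = "pulsating_frame \<alpha> \<beta> \<theta>" and ?\<Psi> = "inertial_frame \<alpha> \<beta> \<theta>"
  have \<alpha>_nz: "\<alpha> t \<noteq> 0" for t
    using \<alpha>_pos[of t] by simp
  have r_\<alpha>: "r t *\<^sub>R (R (\<theta> t) *v b) = \<alpha> t *\<^sub>R (R (\<theta> t) *v (\<sigma> *\<^sub>R b))" for t b
    using \<sigma> by (simp add: \<alpha>_def matrix_vector_mult_scaleR)
  \<comment> \<open>Collisions concern positions only, and the injective position map sends each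
    \<open>\<sigma> *\<^sub>R a i\<close> to the corresponding primary.\<close>
  have mem: "?\<Psi> t y \<in> D t \<longleftrightarrow> y \<in> E" for t y
  proof -
    have "inj (\<lambda>z. R (\<theta> t) *v z)"
      by (rule inj_on_inverseI[where g = "\<lambda>z. R (- \<theta> t) *v z"]) (simp add: R_R)
    then have "R (\<theta> t) *v (\<alpha> t *\<^sub>R z) = r t *\<^sub>R (R (\<theta> t) *v b) \<longleftrightarrow> z = \<sigma> *\<^sub>R b" for z b
      unfolding r_\<alpha> using \<alpha>_nz[of t]
      by (simp only: matrix_vector_mult_scaleR[symmetric] inj_eq scaleR_cancel_left) simp
    then show ?thesis
      by (simp only: D_def E_def collision_free_def inertial_frame_def case_prod_beta
          mem_Collect_eq snd_conv r_def[symmetric])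
  qed
  have map: "?\<Phi> t x \<in> E" if "x \<in> D t" for t x
    using that mem[of t "?\<Phi> t x"] by (simp add: inertial_pulsating_frame \<alpha>_nz)
  have bij: "bij_betw (?\<Phi> t) (D t) E" for t
    by (rule bij_betw_byWitness[where f' = "?\<Psi> t"])
      (auto simp: inertial_pulsating_frame \<alpha>_nz mem map)
  have "continuous_on UNIV r"
    using r' by (meson DERIV_isCont continuous_at_imp_continuous_on)
  then have "continuous_on UNIV \<gamma>" "continuous_on UNIV \<omega>"
    using r \<sigma> unfolding \<gamma>_def \<omega>_def \<alpha>_def
    by (auto intro!: continuous_intros simp: less_imp_neq[symmetric])
  then have "symplectic_coordinate_change D (\<lambda>_. E) ?\<Phi>"
    using bij by (intro symplectic_coordinate_change_pulsating_frame[OF \<alpha> \<beta> \<theta> \<alpha>_nz]) auto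
  moreover have "transforms_hamiltonian D (restricted_hamiltonian N m a p e \<theta>)
      (\<lambda>_. E) (reduced_hamiltonian N m a p e \<sigma>) \<theta> ?\<Phi>"
  proof (rule transforms_hamiltonianI
      [OF \<theta> _ GDERIV_restricted_hamiltonian GDERIV_reduced_hamiltonian map
          inertial_pulsating_frame(1)[where \<alpha> = \<alpha>, OF \<alpha>_nz] differentiable_inertial_frame[OF \<alpha> \<beta> \<theta> \<alpha>_nz]
          has_derivative_pulsating_frame[OF \<alpha> \<beta> \<theta> \<alpha>_nz]
          symplectic_pulsating_frame_deriv[OF \<alpha> \<beta> \<theta> \<alpha>_nz]])
    show "\<omega> t > 0" for t
      using \<alpha>_pos[of t] by (simp add: \<omega>_def)
    fix t and x :: phase
    obtain P q where x: "x = (P, q)" by (cases x)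
    obtain Z z where Zz: "?\<Phi> t x = (Z, z)" by (cases "?\<Phi> t x")
    let ?f = "newton_force N m (\<lambda>i. \<sigma> *\<^sub>R a i) z"
      and ?F = "newton_force N m (\<lambda>i. kepler_radius p e (\<theta> t) *\<^sub>R (R (\<theta> t) *v a i)) q"
    have Z: "Z = R (- \<theta> t) *v (\<alpha> t *\<^sub>R P - \<beta> t *\<^sub>R q)"
      and z: "z = R (- \<theta> t) *v (inverse (\<alpha> t) *\<^sub>R q)"
      using Zz by (auto simp: pulsating_frame_def x)
    have q: "q = \<alpha> t *\<^sub>R (R (\<theta> t) *v z)"
      unfolding z using \<alpha>_nz[of t] by (simp add: R_R matrix_vector_mult_scaleR)
    \<comment> \<open>Similarity with factor \<open>\<alpha> t\<close>: the resulting inverse square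
      of \<alpha> is exactly \<omega>.\<close>
    have F: "?F = \<omega> t *\<^sub>R (R (\<theta> t) *v ?f)"
      unfolding q r_\<alpha>[unfolded r_def] \<omega>_def by (rule newton_force_similarity[OF \<alpha>_pos])
    \<comment> \<open>The remaining factor \<alpha> on the force is r / \<sigma>, the coefficient of
      the reduced potential; the \<gamma> term becomes the quadratic one through
      \<open>\<gamma>\<alpha>\<close>.\<close>
    have momentum: "R (- \<theta> t) *v (\<alpha> t *\<^sub>R ?F - \<gamma> t *\<^sub>R q)
      = \<omega> t *\<^sub>R (\<alpha> t *\<^sub>R ?f - ((p - r t) / p) *\<^sub>R z)"
    proof -
      have "R (- \<theta> t) *v (\<alpha> t *\<^sub>R ?F - \<gamma> t *\<^sub>R q) = (\<alpha> t * \<omega> t) *\<^sub>R ?f - (\<gamma> t * \<alpha> t) *\<^sub>R z"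
        unfolding F by (subst q)
          (simp add: matrix_vector_mult_diff_distrib matrix_vector_mult_scaleR R_R)
      then show ?thesis
        unfolding \<gamma>\<alpha> by (simp add: scaleR_diff_right mult.commute)
    qed
    \<comment> \<open>Factoring out the inverse square of \<alpha> leaves \<alpha> P - \<beta> q,
      which is \<open>Z\<close> before rotation.\<close>
    have position: "R (- \<theta> t) *v (inverse (\<alpha> t) *\<^sub>R P - (\<beta> t / (\<alpha> t)\<^sup>2) *\<^sub>R q) = \<omega> t *\<^sub>R Z"
      unfolding Z \<omega>_def using \<alpha>_nz[of t]
      by (simp add: scaleR_diff_right power2_eq_square field_simps
          flip: matrix_vector_mult_scaleR)
    \<comment> \<open>Since \<open>q\<close> moves with velocity \<open>P\<close>, the term \<beta>
      P from the changing scale cancels the one from the shear, so \<beta> drops out of the momentum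
      equation apart from its presence in \<open>Z\<close>.\<close>
    have deriv: "pulsating_frame_deriv \<alpha> \<beta> \<gamma> \<theta> \<omega> (t, P, q) (1, F, P)
      = (R (- \<theta> t) *v (\<alpha> t *\<^sub>R F - \<gamma> t *\<^sub>R q) - \<omega> t *\<^sub>R (J *v Z),
         R (- \<theta> t) *v (inverse (\<alpha> t) *\<^sub>R P - (\<beta> t / (\<alpha> t)\<^sup>2) *\<^sub>R q) - \<omega> t *\<^sub>R (J *v z))" for F
      by (simp add: pulsating_frame_deriv_def Z z)
    show "pulsating_frame_deriv \<alpha> \<beta> \<gamma> \<theta> \<omega> (t, x) (1, - (- newton_force N m
          (\<lambda>i. kepler_radius p e (\<theta> t) *\<^sub>R (R (\<theta> t) *v a i)) (snd x)), fst x)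
      = \<omega> t *\<^sub>R (- (J *v fst (?\<Phi> t x) + ((p - kepler_radius p e (\<theta> t)) / p) *\<^sub>R snd (?\<Phi> t x)
          - (kepler_radius p e (\<theta> t) / \<sigma>) *\<^sub>R newton_force N m (\<lambda>i. \<sigma> *\<^sub>R a i) (snd (?\<Phi> t x))),
        fst (?\<Phi> t x) - J *v snd (?\<Phi> t x))"
      unfolding x Zz[unfolded x] fst_conv snd_conv minus_minus deriv momentum position
      by (simp add: \<alpha>_def algebra_simps flip: r_def)
  qed (auto simp: D_def E_def)
  ultimately show ?thesis by blast
qed

end
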